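(* Let $q$ be a prime power and let $k=2t$ with $t\ge1$ an integer. The code $\mathcal{C}_{k,q}$ defined in the context is a minimal $\left[(q+1)\frac{k^2}{4},\,k,\,q(k-1)\right]_q$ code.
   Context: Codes: for $v\in\mathbb{F}_q^n$ the support is $\sigma(v)=\{i: v_i\neq0\}$ and the weight is $\omega(v)=|\sigma(v)|$. An $[n,k,d]_q$ code is a $k$-dimensional $\mathbb{F}_q$-linear subspace of $\mathbb{F}_q^n$ whose nonzero codewords have minimum weight $d$. A nonzero codeword $c\in\mathcal{C}$ is minimal if every $c'\in\mathcal{C}$ with $\sigma(c')\subseteq\sigma(c)$ is a scalar multiple of $c$; the code is minimal if all its nonzero codewords are minimal. Construction of $\mathcal{C}_{k,q}$: let $\gamma$ be a primitive element of $\mathbb{F}_{q^2}$ (a generator of $\mathbb{F}_{q^2}^*$), let $M\in\mathbb{F}_q^{2\times2}$ be the companion matrix of its minimal polynomial over $\mathbb{F}_q$, and let $\phi:\mathbb{F}_{q^2}\to\mathbb{F}_q[M]$ be the $\mathbb{F}_q$-algebra isomorphism with $\phi(\gamma)=M$. For a point $P=[(v_1,\dots,v_t)]\in\mathrm{PG}(t-1,q^2)$ let $\bar\varphi(P)\subseteq\mathbb{F}_q^{2t}$ be the $\mathbb{F}_q$-row space of the $2\times 2t$ matrix $(\phi(v_1)\mid\cdots\mid\phi(v_t))$; this is a 2-dimensional subspace (independent of the representative), i.e. a line of $\mathrm{PG}(k-1,q)$. With $e_1,\dots,e_t$ the standard basis of $\mathbb{F}_{q^2}^t$, put $P_\ell=[e_\ell]$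 and $Q_{\ell,m,i}=[e_\ell+\gamma^ie_m]$ for $1\le\ell<m\le t$. For every pair $1\le \ell<m\le t$ choose $i_{\ell,m},j_{\ell,m}\in\{1,\dots,q^2-1\}$ with $j_{\ell,m}-i_{\ell,m}\not\equiv0\bmod (q+1)$. The $t^2$ lines $\bar\varphi(P_\ell)$ $(1\le\ell\le t)$, $\bar\varphi(Q_{\ell,m,i_{\ell,m}})$ and $\bar\varphi(Q_{\ell,m,j_{\ell,m}})$ $(1\le\ell<m\le t)$ of $\mathrm{PG}(k-1,q)$ are pairwise disjoint. $\mathcal{C}_{k,q}$ is the code generated by a matrix with $k$ rows whose columns are vector representatives (one for each point) of all the points in the union of these $t^2$ lines. *)

theory Defs
  imports "Jordan_Normal_Form.VS_Connect"
begin

section \<open>Linear codes\<close>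

definition support :: "'a::zero vec \<Rightarrow> nat set" where
  "support v = {i. i < dim_vec v \<and> v $ i \<noteq> 0}"

definition weight :: "'a::zero vec \<Rightarrow> nat" where
  "weight v = card (support v)"

definition linear_code :: "nat \<Rightarrow> nat \<Rightarrow> nat \<Rightarrow> 'a::field vec set \<Rightarrow> bool" where
  "linear_code n k d C \<longleftrightarrow>
     VectorSpace.subspace class_ring C (module_vec TYPE('a) n) \<and>
     vectorspace.dim class_ring ((module_vec TYPE('a) n)\<lparr>carrier := C\<rparr>) = k \<and>
     (\<exists>c\<in>C. c \<noteq> 0\<^sub>v n \<and> weight c = d) \<and>
     (\<forall>c\<in>C. c \<noteq> 0\<^sub>v n \<longrightarrow> d \<le> weight c)"

definition minimal_codeword :: "'a::field vec set \<Rightarrow> 'a vec \<Rightarrow> bool" where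
  "minimal_codeword C c \<longleftrightarrow> c \<in> C \<and> c \<noteq> 0\<^sub>v (dim_vec c) \<and>
     (\<forall>c'\<in>C. support c' \<subseteq> support c \<longrightarrow> (\<exists>a. c' = a \<cdot>\<^sub>v c))"

definition minimal_code :: "'a::field vec set \<Rightarrow> bool" where
  "minimal_code C \<longleftrightarrow> (\<forall>c\<in>C. c \<noteq> 0\<^sub>v (dim_vec c) \<longrightarrow> minimal_codeword C c)"

definition generated_code :: "'a::field mat \<Rightarrow> 'a vec set" where
  "generated_code G = vec_space.row_space (dim_col G) G"

section \<open>The quadratic extension and its matrix representation\<close>

definition primitive_element :: "'b::field \<Rightarrow> bool" where
  "primitive_element g \<longleftrightarrow> range (\<lambda>i::nat. g ^ i) = UNIV - {0}"

text \<open>Here and below, \<open>\<iota>\<close> is the embedding of the base field into the extension field.\<close>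

definition min_poly :: "('a::field \<Rightarrow> 'b::field) \<Rightarrow> 'b \<Rightarrow> 'a poly" where
  "min_poly \<iota> x = (THE p. lead_coeff p = 1 \<and> poly (map_poly \<iota> p) x = 0 \<and>
     (\<forall>r. r \<noteq> 0 \<and> poly (map_poly \<iota> r) x = 0 \<longrightarrow> degree p \<le> degree r))"

text \<open>The convention with ones on the superdiagonal and the negated coefficients in the last row.\<close>

definition companion_mat :: "'a::field poly \<Rightarrow> 'a mat" where
  "companion_mat p = (let n = degree p in
     mat n n (\<lambda>(r, s). if Suc r = n then - coeff p s else if s = Suc r then 1 else 0))"

definition poly_of_mat :: "'a::field poly \<Rightarrow> 'a mat \<Rightarrow> 'a mat" where
  "poly_of_mat p M = mat (dim_row M) (dim_row M)
     (\<lambda>(r, s). \<Sum>i\<le>degree p. coeff p i * (M ^\<^sub>m i) $$ (r, s))"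

definition mat_algebra :: "'a::field mat \<Rightarrow> 'a mat set" where
  "mat_algebra M = range (\<lambda>p. poly_of_mat p M)"

definition algebra_iso :: "('a::field \<Rightarrow> 'b::field) \<Rightarrow> ('b \<Rightarrow> 'a mat) \<Rightarrow> 'a mat \<Rightarrow> bool" where
  "algebra_iso \<iota> \<phi> M \<longleftrightarrow>
     bij_betw \<phi> UNIV (mat_algebra M) \<and>
     \<phi> 1 = 1\<^sub>m (dim_row M) \<and>
     (\<forall>x y. \<phi> (x + y) = \<phi> x + \<phi> y) \<and>
     (\<forall>x y. \<phi> (x * y) = \<phi> x * \<phi> y) \<and>
     (\<forall>a x. \<phi> (\<iota> a * x) = a \<cdot>\<^sub>m \<phi> x)"

section \<open>Projective points, field reduction and the code\<close>

text \<open>A projective point is the one-dimensional subspace spanned by a nonzero vector.\<close>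

definition proj_point :: "'a::field vec \<Rightarrow> 'a vec set" where
  "proj_point v = range (\<lambda>a. a \<cdot>\<^sub>v v)"

definition points_of :: "'a::field vec set \<Rightarrow> 'a vec set set" where
  "points_of W = {proj_point v | v. v \<in> W \<and> v \<noteq> 0\<^sub>v (dim_vec v)}"

definition block_row :: "('b \<Rightarrow> 'a mat) \<Rightarrow> 'b vec \<Rightarrow> 'a mat" where
  "block_row \<phi> v = mat 2 (2 * dim_vec v) (\<lambda>(r, s). \<phi> (v $ (s div 2)) $$ (r, s mod 2))"

text \<open>The row space of the block matrix of any representative of the point; all representatives
  give the same row space.\<close>

definition field_reduction :: "('b::field \<Rightarrow> 'a::field mat) \<Rightarrow> 'b vec set \<Rightarrow> 'a vec set" where
  "field_reduction \<phi> P = (let v = (SOME v. v \<in> P \<and> v \<noteq> 0\<^sub>v (dim_vec v)) in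
     vec_space.row_space (2 * dim_vec v) (block_row \<phi> v))"

text \<open>Coordinates are numbered from 0, so the index pairs are those with \<open>l < m < t\<close>.\<close>

definition point_P :: "nat \<Rightarrow> nat \<Rightarrow> 'b::field vec set" where
  "point_P t l = proj_point (unit_vec t l)"

definition point_Q :: "'b::field \<Rightarrow> nat \<Rightarrow> nat \<Rightarrow> nat \<Rightarrow> nat \<Rightarrow> 'b vec set" where
  "point_Q \<gamma> t l m i = proj_point (unit_vec t l + \<gamma> ^ i \<cdot>\<^sub>v unit_vec t m)"

definition code_lines :: "('b::field \<Rightarrow> 'a::field mat) \<Rightarrow> 'b \<Rightarrow> nat \<Rightarrow>
    (nat \<Rightarrow> nat \<Rightarrow> nat) \<Rightarrow> (nat \<Rightarrow> nat \<Rightarrow> nat) \<Rightarrow> 'a vec set set" where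
  "code_lines \<phi> \<gamma> t i j =
     {field_reduction \<phi> (point_P t l) | l. l < t} \<union>
     {field_reduction \<phi> (point_Q \<gamma> t l m (i l m)) | l m. l < m \<and> m < t} \<union>
     {field_reduction \<phi> (point_Q \<gamma> t l m (j l m)) | l m. l < m \<and> m < t}"

text \<open>The columns of \<open>G\<close> are vector representatives, one for each point, of the points in \<open>S\<close>.\<close>

definition columns_represent :: "'a::field mat \<Rightarrow> 'a vec set set \<Rightarrow> bool" where
  "columns_represent G S \<longleftrightarrow> bij_betw (\<lambda>c. proj_point (col G c)) {..<dim_col G} S"

end

theory Submission
  imports Defs "Jordan_Normal_Form.DL_Rank" "Berlekamp_Zassenhaus.Berlekamp_Type_Based"
begin

text \<open>
  Write \<open>lin y\<close> for the upper left entry of \<open>\<phi> y\<close>. Expanding every entry of a vector over the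
  quadratic extension to the first row, respectively the first column, of its matrix gives maps
  \<open>expand_row\<close> and \<open>expand_col\<close> with \<open>expand_row v \<bullet> expand_col x = lin (v \<bullet> x)\<close>. The nonzero vectors
  of the line of \<open>v\<close> are the \<open>expand_row (z \<cdot>\<^sub>v v)\<close> with \<open>z \<noteq> 0\<close>, and each codeword is given by some
  \<open>expand_col x\<close>, so that the line is contained in the hyperplane of \<open>x\<close> iff \<open>v \<bullet> x = 0\<close>, and otherwise
  contributes \<open>q\<close> to the weight.

  If \<open>x $ l \<noteq> 0\<close>, then of the three lines with index pairs \<open>(l, m)\<close>, \<open>(m, l)\<close>, \<open>(m, m)\<close> at least two
  are not contained in the hyperplane, for every \<open>m \<noteq> l\<close>. Together with \<open>(l, l)\<close> this is \<open>2 * t - 1\<close>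
  lines, and a unit vector attains this bound.

  If the codeword of \<open>y\<close> vanishes wherever that of \<open>x\<close> does, then \<open>v \<bullet> y\<close> is a base field multiple of
  \<open>v \<bullet> x\<close> for each of the \<open>t\<^sup>2\<close> representatives \<open>v\<close>. The unit vectors give \<open>y $ l = \<iota> (c l) * x $ l\<close>,
  and \<open>c l \<noteq> c m\<close> would put the ratio of the two slopes \<open>\<gamma> ^ i l m\<close>, \<open>\<gamma> ^ j l m\<close> into the base field,
  that is, \<open>q + 1\<close> would divide \<open>j l m - i l m\<close>.
\<close>

section \<open>Generated codes and projective systems\<close>

lemma generated_code_eq:
  "generated_code G = (\<lambda>u. G\<^sup>T *\<^sub>v u) ` carrier_vec (dim_row G)"
proof -
  have "G \<in> carrier_mat (dim_row G) (dim_col G)" by simp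
  from vec_space.row_space_eq[OF this] show ?thesis
    unfolding generated_code_def by (auto intro!: carrier_vecI)
qed

lemma dim_generated_code:
  fixes G :: "'a::field mat"
  assumes inj: "\<And>u. u \<in> carrier_vec (dim_row G) \<Longrightarrow> G\<^sup>T *\<^sub>v u = 0\<^sub>v (dim_col G) \<Longrightarrow> u = 0\<^sub>v (dim_row G)"
  shows "vectorspace.dim class_ring ((module_vec TYPE('a) (dim_col G))\<lparr>carrier := generated_code G\<rparr>) = dim_row G"
proof -
  interpret vec_space "TYPE('a)" "dim_col G" .
  have GT: "G\<^sup>T \<in> carrier_mat (dim_col G) (dim_row G)" by simp
  \<comment> \<open>Independence is a property of the set of columns and misses repetitions. Two
    equal columns would put the difference of two unit vectors into the kernel, against
    \<open>inj\<close>.\<close>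
  have dist: "distinct (cols G\<^sup>T)"
  proof (rule ccontr)
    assume "\<not> distinct (cols G\<^sup>T)"
    then obtain r s where rs: "r < dim_row G" "s < dim_row G" "r \<noteq> s" "col G\<^sup>T r = col G\<^sup>T s"
      by (auto simp: distinct_conv_nth)
    let ?u = "unit_vec (dim_row G) r - unit_vec (dim_row G) s :: 'a vec"
    have "G\<^sup>T *\<^sub>v ?u = 0\<^sub>v (dim_col G)"
    proof (rule eq_vecI)
      fix c assume "c < dim_vec (0\<^sub>v (dim_col G) :: 'a vec)"
      then have c: "c < dim_col G" by simp
      have "col G c \<bullet> ?u = col G c $ r - col G c $ s"
        using rs by (simp add: scalar_prod_minus_distrib[OF col_dim])
      also have "\<dots> = col G\<^sup>T r $ c - col G\<^sup>T s $ c" using rs(1,2) c by simp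
      also have "\<dots> = 0" unfolding rs(4) by simp
      finally show "(G\<^sup>T *\<^sub>v ?u) $ c = 0\<^sub>v (dim_col G) $ c" using c by simp
    qed simp
    then have "?u = 0\<^sub>v (dim_row G)" using inj by simp
    then have "?u $ r = 0" using rs by simp
    then show False using rs by simp
  qed
  have "lin_indpt (set (cols G\<^sup>T))"
    using lin_depE[OF GT _ dist] inj by metis
  then have "rank G\<^sup>T = dim_row G"
    by (rule lin_indpt_full_rank[OF GT dist])
  then show ?thesis
    unfolding rank_def generated_code_def row_space_def by simp
qed

lemma subspace_generated_code:
  "VectorSpace.subspace class_ring (generated_code (G :: 'a::field mat)) (module_vec TYPE('a) (dim_col G))"
proof -
  interpret vec_space "TYPE('a)" "dim_col G" .
  show ?thesis unfolding generated_code_def row_space_def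
    by (rule span_is_subspace) (auto simp: rows_def)
qed

lemma zero_smult_vec: "v \<in> carrier_vec n \<Longrightarrow> (0 :: 'a::semiring_0) \<cdot>\<^sub>v v = 0\<^sub>v n"
  by (intro eq_vecI) auto

text \<open>Each projective point has \<open>CARD('a) - 1\<close> representatives, which reduces counting columns to
  counting vectors.\<close>

lemma card_columns_represent:
  fixes G :: "'a::{field,finite} mat"
  assumes G: "columns_represent G (proj_point ` W)"
    and W: "W \<subseteq> carrier_vec (dim_row G) - {0\<^sub>v (dim_row G)}"
    and scale: "\<And>a w. a \<noteq> 0 \<Longrightarrow> w \<in> W \<Longrightarrow> a \<cdot>\<^sub>v w \<in> W"
    and P: "\<And>a w. a \<noteq> 0 \<Longrightarrow> w \<in> carrier_vec (dim_row G) \<Longrightarrow> P (a \<cdot>\<^sub>v w) \<longleftrightarrow> P w"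
  shows "card {c. c < dim_col G \<and> P (col G c)} * (CARD('a) - 1) = card {w \<in> W. P w}"
    and "w \<in> W \<Longrightarrow> \<exists>a c. c < dim_col G \<and> w = a \<cdot>\<^sub>v col G c"
proof -
  have bij: "inj_on (\<lambda>c. proj_point (col G c)) {..<dim_col G}"
    "(\<lambda>c. proj_point (col G c)) ` {..<dim_col G} = proj_point ` W"
    using G by (auto simp: columns_represent_def bij_betw_def)
  have self: "v \<in> proj_point v" for v :: "'a vec"
    unfolding proj_point_def by (metis one_smult_vec rangeI)
  have pp_smult: "proj_point (a \<cdot>\<^sub>v v) = proj_point v" if "a \<noteq> 0" for a and v :: "'a vec"
  proof -
    have "range (\<lambda>b. b \<cdot>\<^sub>v (a \<cdot>\<^sub>v v)) = (\<lambda>b. b \<cdot>\<^sub>v v) ` range (\<lambda>b. b * a)"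
      by (simp add: image_image smult_smult_assoc)
    moreover have "b \<in> range (\<lambda>b. b * a)" for b
      using that by (intro image_eqI[of _ _ "b / a"]) simp_all
    ultimately show ?thesis unfolding proj_point_def by (metis UNIV_eq_I)
  qed
  \<comment> \<open>Only the point of a column is known, so the column and some \<open>w\<close> in
    \<open>W\<close> are multiples of each other. A zero factor \<open>a\<close> would make both of
    them zero.\<close>
  have colW: "col G c \<in> W" if c: "c < dim_col G" for c
  proof -
    obtain w where w: "w \<in> W" "proj_point (col G c) = proj_point w"
      using bij(2) c by blast
    have "col G c \<in> proj_point w" "w \<in> proj_point (col G c)"
      using w(2) self by metis+
    then obtain a b where ab: "col G c = a \<cdot>\<^sub>v w" "w = b \<cdot>\<^sub>v col G c"
      unfolding proj_point_def by blast
    have "a \<noteq> 0"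
    proof
      assume "a = 0"
      then have "w = 0\<^sub>v (dim_row G)"
        using ab(2) W w(1) by (subst ab(2), subst ab(1)) (auto intro!: eq_vecI)
      then show False using w W by auto
    qed
    then show ?thesis unfolding ab(1) by (intro scale w(1))
  qed
  show ex: "\<exists>a c. c < dim_col G \<and> w = a \<cdot>\<^sub>v col G c" if "w \<in> W" for w
  proof -
    have "proj_point w \<in> (\<lambda>c. proj_point (col G c)) ` {..<dim_col G}"
      unfolding bij(2) using that by (rule imageI)
    then obtain c where "c < dim_col G" "proj_point (col G c) = proj_point w"
      by (elim imageE) simp
    moreover from this have "w \<in> proj_point (col G c)" using self by metis
    ultimately show ?thesis unfolding proj_point_def by blast
  qed
  \<comment> \<open>Every vector of \<open>W\<close> is a multiple of exactly one column, by exactly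
    one nonzero scalar.\<close>
  let ?f = "\<lambda>(c, a). a \<cdot>\<^sub>v col G c"
  have "bij_betw ?f ({c. c < dim_col G \<and> P (col G c)} \<times> (UNIV - {0})) {w \<in> W. P w}"
  unfolding bij_betw_def
  proof
    show "inj_on ?f ({c. c < dim_col G \<and> P (col G c)} \<times> (UNIV - {0}))"
    proof (rule inj_onI)
      fix x y assume xy: "x \<in> {c. c < dim_col G \<and> P (col G c)} \<times> (UNIV - {0})"
        "y \<in> {c. c < dim_col G \<and> P (col G c)} \<times> (UNIV - {0})" "?f x = ?f y"
      obtain c a d b where [simp]: "x = (c, a)" "y = (d, b)" by (cases x, cases y)
      have *: "c < dim_col G" "d < dim_col G" "a \<noteq> 0" "b \<noteq> 0"
        "a \<cdot>\<^sub>v col G c = b \<cdot>\<^sub>v col G d" using xy by auto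
      then have "proj_point (col G c) = proj_point (col G d)" by (metis pp_smult)
      then have cd: "c = d" using * bij(1) by (auto simp: inj_on_def)
      have "col G c \<in> carrier_vec (dim_row G) - {0\<^sub>v (dim_row G)}" using colW * W by blast
      then obtain r where r: "r < dim_row G" "col G c $ r \<noteq> 0"
        by (metis DiffD1 DiffD2 eq_vecI carrier_vecD index_zero_vec insertI1)
      have "(a \<cdot>\<^sub>v col G c) $ r = (b \<cdot>\<^sub>v col G c) $ r" using *(5) cd by simp
      then show "x = y" using cd r by simp
    qed
    show "?f ` ({c. c < dim_col G \<and> P (col G c)} \<times> (UNIV - {0})) = {w \<in> W. P w}" (is "?L = ?R")
    proof
      show "?L \<subseteq> ?R" using scale colW P W by (auto simp: col_def)
      show "?R \<subseteq> ?L"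
      proof
        fix w assume w: "w \<in> ?R"
        then obtain a c where ac: "c < dim_col G" "w = a \<cdot>\<^sub>v col G c" using ex by blast
        have "a \<noteq> 0"
        proof
          assume "a = 0"
          then have "w = 0\<^sub>v (dim_row G)" using ac by (intro eq_vecI) auto
          then show False using w W by auto
        qed
        then show "w \<in> ?L" using ac w P by (auto intro!: image_eqI[of _ _ "(c, a)"])
      qed
    qed
  qed
  from bij_betw_same_card[OF this] show "card {c. c < dim_col G \<and> P (col G c)} * (CARD('a) - 1) = card {w \<in> W. P w}"
    by (simp add: card_cartesian_product card_Diff_subset)
qed

section \<open>Finite fields and primitive elements\<close>

lemma two_le_card_field: "2 \<le> CARD('a::{field,finite})"
  using card_mono[of "UNIV :: 'a set" "{0, 1}"] by simp

text \<open>Multiplication by \<open>x\<close> permutes the nonzero elements, so it leaves their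
  product unchanged, and this product can be cancelled.\<close>

lemma finite_field_power_card_diff_1:
  fixes x :: "'a::{field,finite}"
  assumes "x \<noteq> 0"
  shows "x ^ (CARD('a) - 1) = 1"
proof -
  have "(\<Prod>y\<in>UNIV-{0}. x * y) = (\<Prod>y\<in>UNIV-{0}. y)"
    by (rule prod.reindex_bij_witness[of _ "\<lambda>y. y / x" "\<lambda>y. x * y"]) (use assms in auto)
  then have "x ^ (CARD('a) - 1) * \<Prod>(UNIV - {0}) = 1 * \<Prod>(UNIV - {0})"
    by (simp add: prod.distrib card_Diff_subset)
  then show ?thesis by (simp add: prod_zero_iff)
qed

lemma primitive_element_nonzero: "primitive_element g \<Longrightarrow> g \<noteq> 0"
  unfolding primitive_element_def by (metis Diff_iff insertI1 power_one_right rangeI)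

text \<open>If \<open>g ^ r = 1\<close> with \<open>r > 0\<close>, exponents matter only modulo
  \<open>r\<close>, so \<open>g\<close> has at most \<open>r\<close> powers. For a nonzero remainder
  \<open>r\<close> of \<open>d\<close> these are too few to reach every nonzero element.\<close>

lemma primitive_element_power_eq_1:
  fixes g :: "'b::{field,finite}"
  assumes g: "primitive_element g" and "g ^ d = 1"
  shows "CARD('b) - 1 dvd d"
proof (rule ccontr)
  let ?n = "CARD('b) - 1"
  have g0: "g \<noteq> 0" using g by (rule primitive_element_nonzero)
  assume "\<not> ?n dvd d"
  define r where "r = d mod ?n"
  have n: "0 < ?n" using two_le_card_field[where 'a = 'b] by simp
  have r: "0 < r" "r < ?n" using \<open>\<not> ?n dvd d\<close> n by (auto simp: r_def dvd_eq_mod_eq_0)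
  have "g ^ d = g ^ (?n * (d div ?n) + r)" unfolding r_def by simp
  also have "\<dots> = g ^ r"
    by (simp only: power_add power_mult finite_field_power_card_diff_1[OF g0] power_one mult_1)
  finally have gr: "g ^ r = 1" using assms by simp
  have "g ^ i = g ^ (i mod r)" for i
  proof -
    have "g ^ i = g ^ (r * (i div r) + i mod r)" by simp
    also have "\<dots> = g ^ (i mod r)" by (simp only: power_add power_mult gr power_one mult_1)
    finally show ?thesis .
  qed
  then have "range (\<lambda>i. g ^ i) \<subseteq> (\<lambda>i. g ^ i) ` {..<r}"
    using r by (metis (mono_tags, lifting) image_eqI image_subsetI lessThan_iff mod_less_divisor)
  then have "card (UNIV - {0 :: 'b}) \<le> card ((\<lambda>i. g ^ i) ` {..<r})"
    using g by (metis card_mono finite_imageI finite_lessThan primitive_element_def)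
  also have "\<dots> \<le> r" using card_image_le[of "{..<r}" "\<lambda>i. g ^ i"] by simp
  finally show False using r by (simp add: card_Diff_subset)
qed

text \<open>Raising to the power \<open>q - 1\<close> removes the factor from the base field. Then
  \<open>q\<^sup>2 - 1 = (q + 1) * (q - 1)\<close> divides \<open>(n - m) * (q - 1)\<close>.\<close>

lemma primitive_element_power_ratio:
  fixes \<iota> :: "'a::{field,finite} \<Rightarrow> 'b::{field,finite}"
  assumes hom: "field_hom \<iota>" and card: "CARD('b) = CARD('a)\<^sup>2"
    and g: "primitive_element g" and eq: "g ^ n = \<iota> c * g ^ m"
  shows "int (CARD('a) + 1) dvd int n - int m"
proof -
  interpret field_hom \<iota> by fact
  let ?q = "CARD('a)"
  have q: "2 \<le> ?q" by (rule two_le_card_field)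
  have g0: "g \<noteq> 0" using g by (rule primitive_element_nonzero)
  then have "c \<noteq> 0" using eq by auto
  then have "\<iota> c ^ (?q - 1) = 1"
    using finite_field_power_card_diff_1[of c] by (metis hom_one hom_power)
  then have *: "g ^ (n * (?q - 1)) = g ^ (m * (?q - 1))"
    unfolding power_mult eq by (simp add: power_mult_distrib)
  have split: "CARD('b) - 1 = (?q + 1) * (?q - 1)"
    using card q by (simp add: power2_eq_square algebra_simps diff_mult_distrib2)
  \<comment> \<open>Stated for arbitrary exponents, since truncated subtraction requires it once for
    each order of \<open>n\<close> and \<open>m\<close>.\<close>
  have main: "?q + 1 dvd n' - m'" if "m' \<le> n'" "g ^ (n' * (?q - 1)) = g ^ (m' * (?q - 1))" for n' m'
  proof -
    have "g ^ (n' * (?q - 1)) = g ^ (m' * (?q - 1)) * g ^ ((n' - m') * (?q - 1))"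
      using that(1) by (metis power_add add_mult_distrib le_add_diff_inverse)
    then have "g ^ ((n' - m') * (?q - 1)) = 1" using that g0 by simp
    then have "(?q + 1) * (?q - 1) dvd (n' - m') * (?q - 1)"
      using primitive_element_power_eq_1[OF g] split by metis
    moreover have "0 < ?q - 1" using q by simp
    ultimately show ?thesis by (metis mult.commute nat_mult_dvd_cancel1)
  qed
  show ?thesis
  proof (cases "m \<le> n")
    case True
    then show ?thesis using main[OF True *] by (metis int_dvd_int_iff of_nat_diff)
  next
    case False
    then have "int (?q + 1) dvd int m - int n"
      using main[OF _ *[symmetric]] by (metis int_dvd_int_iff of_nat_diff nat_le_linear)
    then show ?thesis by (simp only: dvd_diff_commute)
  qed
qed

text \<open>The degree is the size of the companion matrix. Existence and uniqueness for the
  definite description in \<open>min_poly\<close> are settled on the way.\<close>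

lemma degree_min_poly_primitive:
  fixes \<iota> :: "'a::{field,finite} \<Rightarrow> 'b::{field,finite}"
  assumes hom: "field_hom \<iota>" and card: "CARD('b) = CARD('a)\<^sup>2" and g: "primitive_element g"
  shows "degree (min_poly \<iota> g) = 2"
proof -
  interpret field_hom \<iota> by fact
  interpret p: map_poly_idom_hom \<iota> ..
  let ?e = "\<lambda>p. poly (map_poly \<iota> p) g"
  let ?q = "CARD('a)"
  have q: "2 \<le> ?q" by (rule two_le_card_field)
  \<comment> \<open>Pigeonhole on the quadratic polynomials, of which there are more than elements of the extension.\<close>
  have "\<not> inj (\<lambda>(a, b, c). ?e [:a, b, c:])"
  proof
    assume "inj (\<lambda>(a, b, c). ?e [:a, b, c:])"
    then have "card (UNIV :: ('a \<times> 'a \<times> 'a) set) \<le> CARD('b)" by (intro card_inj_on_le) auto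
    then have "?q * (?q * ?q) \<le> ?q * ?q"
      by (simp add: card power2_eq_square flip: UNIV_Times_UNIV)
    then show False using q by simp
  qed
  then obtain a b c a' b' c' where "(a, b, c) \<noteq> (a', b', c')" "?e [:a, b, c:] = ?e [:a', b', c':]"
    unfolding inj_on_def by fast
  then obtain p p' where "p \<noteq> p'" "?e p = ?e p'" "degree p \<le> 2" "degree p' \<le> 2"
    using that[of "[:a, b, c:]" "[:a', b', c':]"] by simp
  then have deg2: "p - p' \<noteq> 0" "?e (p - p') = 0" "degree (p - p') \<le> 2"
    by (auto simp: hom_distribs degree_diff_le)
  define Z where "Z = (\<lambda>p. p \<noteq> 0 \<and> ?e p = 0)"
  have "Z (p - p')" using deg2 by (simp add: Z_def)
  then obtain f where f: "Z f" "\<And>r. Z r \<Longrightarrow> degree f \<le> degree r"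
    using ex_has_least_nat[of Z _ degree] by blast
  have "degree f \<le> 2" using f(2)[OF \<open>Z (p - p')\<close>] deg2 by simp
  define h where "h = smult (inverse (lead_coeff f)) f"
  have h: "lead_coeff h = 1" "?e h = 0" "degree h = degree f"
    using f(1) by (auto simp: h_def Z_def hom_distribs)
  have "min_poly \<iota> g = h"
    unfolding min_poly_def
  proof (rule the_equality)
    show "lead_coeff h = 1 \<and> ?e h = 0 \<and> (\<forall>r. r \<noteq> 0 \<and> ?e r = 0 \<longrightarrow> degree h \<le> degree r)"
      using h f by (simp add: Z_def)
  next
    fix s assume s: "lead_coeff s = 1 \<and> ?e s = 0 \<and> (\<forall>r. r \<noteq> 0 \<and> ?e r = 0 \<longrightarrow> degree s \<le> degree r)"
    have s0: "s \<noteq> 0" and h0: "h \<noteq> 0" using s h by auto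
    have deg: "degree s = degree h"
      using s h s0 h0 f(2)[of s] by (intro antisym) (auto simp: Z_def)
    show "s = h"
    proof (rule ccontr)
      \<comment> \<open>Both polynomials are monic of the same least degree, so their leading terms
        cancel in \<open>s - h\<close>, which still has the root \<open>g\<close>.\<close>
      assume "s \<noteq> h"
      then have "degree s \<le> degree (s - h)"
        using s h by (auto simp: hom_distribs)
      moreover have "degree (s - h) \<le> degree s" using deg by (simp add: degree_diff_le)
      ultimately have "lead_coeff (s - h) = 0" using s h deg by simp
      then show False using \<open>s \<noteq> h\<close> by (metis leading_coeff_0_iff right_minus_eq)
    qed
  qed
  \<comment> \<open>A root of a polynomial of degree at most 1 lies in the base field, and so do its
    powers; for \<open>g\<close> these exhaust the nonzero elements of the larger field.\<close>
  moreover have "2 \<le> degree f"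
  proof (rule ccontr)
    assume "\<not> 2 \<le> degree f"
    then obtain a b where ab: "f = [:a, b:]"
      by (metis degree_eq_zeroE degree1_coeffs less_2_cases_iff not_le numeral_2_eq_2 One_nat_def pCons_0_0)
    then have eq: "\<iota> a + g * \<iota> b = 0" using f(1) by (simp add: Z_def hom_distribs)
    have "b \<noteq> 0" using eq f(1) ab by (auto simp: Z_def)
    then have "\<iota> b \<noteq> 0" by simp
    moreover have "g * \<iota> b = \<iota> (- a)"
      using eq by (simp only: hom_uminus eq_neg_iff_add_eq_0 add.commute)
    ultimately have "g = \<iota> (- a) / \<iota> b" by (rule nonzero_eq_divide_eq[THEN iffD2])
    also have "\<dots> = \<iota> (- a / b)" by (simp only: hom_div)
    finally have "g ^ i = \<iota> ((- a / b) ^ i)" for i by (simp only: hom_power)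
    then have "range (\<lambda>i. g ^ i) \<subseteq> range \<iota>" by auto
    then have "UNIV - {0} \<subseteq> range \<iota>" using g by (simp only: primitive_element_def)
    moreover have "\<iota> 0 \<in> range \<iota>" by (rule rangeI)
    ultimately have "UNIV \<subseteq> range \<iota>" by auto
    then have "CARD('b) \<le> ?q" by (metis card_image_le card_mono finite le_trans)
    then show False using q by (simp add: card power2_eq_square)
  qed
  ultimately show ?thesis using h \<open>degree f \<le> 2\<close> by simp
qed

section \<open>Matrix representations of the quadratic extension\<close>

locale quadratic_matrix_rep = field_hom \<iota>
  for \<iota> :: "'a::{field,finite} \<Rightarrow> 'b::{field,finite}" +
  fixes \<phi> :: "'b \<Rightarrow> 'a mat"
  assumes card_ext: "CARD('b) = CARD('a)\<^sup>2"
    and rep_carrier: "\<phi> x \<in> carrier_mat 2 2"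
    and rep_one: "\<phi> 1 = 1\<^sub>m 2"
    and rep_add: "\<phi> (x + y) = \<phi> x + \<phi> y"
    and rep_mult: "\<phi> (x * y) = \<phi> x * \<phi> y"
    and rep_scale: "\<phi> (\<iota> a * x) = a \<cdot>\<^sub>m \<phi> x"
begin

lemma entry_add: "r < 2 \<Longrightarrow> s < 2 \<Longrightarrow> \<phi> (x + y) $$ (r, s) = \<phi> x $$ (r, s) + \<phi> y $$ (r, s)"
  using rep_carrier[of x] rep_carrier[of y] by (auto simp: rep_add)

lemma entry_mult:
  "r < 2 \<Longrightarrow> s < 2 \<Longrightarrow>
    \<phi> (x * y) $$ (r, s) = \<phi> x $$ (r, 0) * \<phi> y $$ (0, s) + \<phi> x $$ (r, 1) * \<phi> y $$ (1, s)"
  using rep_carrier[of x] rep_carrier[of y]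
  by (auto simp: rep_mult scalar_prod_def numeral_2_eq_2)

lemma entry_scale: "r < 2 \<Longrightarrow> s < 2 \<Longrightarrow> \<phi> (\<iota> a * x) $$ (r, s) = a * \<phi> x $$ (r, s)"
  using rep_carrier[of x] by (auto simp: rep_scale)

lemma entry_diff:
  assumes "r < 2" "s < 2" shows "\<phi> (x - y) $$ (r, s) = \<phi> x $$ (r, s) - \<phi> y $$ (r, s)"
  using entry_add[OF assms, of "x - y" y] by simp

section \<open>A nondegenerate linear functional on the extension\<close>

definition lin :: "'b \<Rightarrow> 'a" where "lin y = \<phi> y $$ (0, 0)"

lemma lin_add: "lin (x + y) = lin x + lin y"
  and lin_diff: "lin (x - y) = lin x - lin y"
  and lin_scale: "lin (\<iota> a * x) = a * lin x"
  by (simp_all add: lin_def entry_add entry_diff entry_scale)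

lemma lin_1: "lin 1 = 1"
  by (simp add: lin_def rep_one)

lemma lin_0: "lin 0 = 0"
  using lin_scale[of 0 0] by simp

lemma lin_of_base: "lin (\<iota> a) = a"
  using lin_scale[of a 1] lin_1 by simp

lemma lin_sum: "lin (sum f A) = (\<Sum>i\<in>A. lin (f i))"
  by (induction A rule: infinite_finite_induct) (simp_all add: lin_0 lin_add)

text \<open>The choice \<open>z = inverse y\<close> gives \<open>lin 1 = 1\<close>. Thus
  \<open>lin\<close> can take the part usually played by the trace.\<close>

lemma lin_nondegenerate:
  assumes "\<And>z. lin (z * y) = 0"
  shows "y = 0"
  using assms[of "inverse y"] lin_1 by (cases "y = 0") auto

text \<open>After division by \<open>y\<close>, each \<open>z\<close> is
  \<open>\<iota> (lin z)\<close> plus an element of the kernel of \<open>lin\<close>, which is also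
  killed by \<open>z \<mapsto> lin (z * u)\<close>. Hence
  \<open>lin (z * u) = lin z * lin u\<close>, and nondegeneracy gives
  \<open>u = \<iota> (lin u)\<close>.\<close>

lemma lin_proportional:
  assumes "\<And>z. lin (z * y) = 0 \<Longrightarrow> lin (z * y') = 0"
  shows "\<exists>c. y' = \<iota> c * y"
proof (cases "y = 0")
  case True
  then have "y' = 0" using assms lin_0 by (intro lin_nondegenerate) simp
  then show ?thesis using True by simp
next
  case False
  define u where "u = y' / y"
  have ker: "lin (z * u) = 0" if "lin z = 0" for z
    using assms[of "z / y"] that False by (simp add: u_def)
  have "lin (z * (u - \<iota> (lin u))) = 0" for z
  proof -
    have "lin ((z - \<iota> (lin z)) * u) = 0"
      by (intro ker) (simp add: lin_diff lin_of_base)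
    then have "lin (z * u) = lin z * lin u"
      by (simp only: left_diff_distrib lin_diff lin_scale right_minus_eq)
    moreover have "lin (z * (u - \<iota> (lin u))) = lin (z * u) - lin u * lin z"
      by (simp only: right_diff_distrib mult.commute[of z "\<iota> _"] lin_diff lin_scale)
    ultimately show ?thesis by simp
  qed
  then have "u - \<iota> (lin u) = 0" by (rule lin_nondegenerate)
  then show ?thesis using False by (auto simp: u_def field_simps)
qed

text \<open>The kernel of \<open>lin\<close> is a complement of the base field, so it has
  \<open>q\<close> elements and leaves \<open>q\<^sup>2 - q\<close>. These are the representatives
  of the \<open>q\<close> points of a line outside a hyperplane.\<close>

lemma card_lin_nonzero:
  "card {z. z \<noteq> 0 \<and> lin (z * y) \<noteq> 0} = (if y = 0 then 0 else CARD('a) * (CARD('a) - 1))"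
proof (cases "y = 0")
  case True
  then show ?thesis by (simp add: lin_0)
next
  case False
  let ?q = "CARD('a)"
  have "bij_betw (\<lambda>z. (z - \<iota> (lin z), lin z)) UNIV ({z. lin z = 0} \<times> UNIV)"
    by (rule bij_betwI[of _ _ _ "\<lambda>(k, a). k + \<iota> a"]) (auto simp: lin_diff lin_add lin_of_base)
  from bij_betw_same_card[OF this] have "?q * ?q = card {z. lin z = 0} * ?q"
    by (simp add: card_cartesian_product card_ext power2_eq_square)
  then have ker: "card {z. lin z = 0} = ?q" by simp
  have "bij_betw (\<lambda>z. z * y) {z. z \<noteq> 0 \<and> lin (z * y) \<noteq> 0} (UNIV - {z. lin z = 0})"
    using False by (intro bij_betwI[of _ _ _ "\<lambda>z. z / y"]) (auto simp: lin_0)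
  from bij_betw_same_card[OF this] have "card {z. z \<noteq> 0 \<and> lin (z * y) \<noteq> 0} = ?q * ?q - ?q"
    by (simp add: card_Diff_subset ker card_ext power2_eq_square)
  then show ?thesis using False by (simp add: diff_mult_distrib2)
qed

text \<open>If \<open>\<phi> x\<close> and \<open>\<phi> y\<close> share the first row,
  \<open>lin ((x - y) * z)\<close> vanishes for all \<open>z\<close>. So the map is injective
  between sets of size \<open>q\<^sup>2\<close>.\<close>

lemma first_row_surj:
  assumes "a \<in> carrier_vec 2"
  shows "\<exists>y. a = vec 2 (\<lambda>b. \<phi> y $$ (0, b))"
proof -
  let ?f = "\<lambda>y. vec 2 (\<lambda>b. \<phi> y $$ (0, b))"
  have "inj ?f"
  proof (rule injI)
    fix x y assume eq: "?f x = ?f y"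
    have "\<phi> (x - y) $$ (0, b) = 0" if "b < 2" for b
      using that arg_cong[OF eq, of "\<lambda>v. v $ b"] by (simp add: entry_diff)
    then have "lin ((x - y) * z) = 0" for z by (simp add: lin_def entry_mult)
    then show "x = y" using lin_nondegenerate[of "x - y"] by (simp add: mult.commute)
  qed
  then have "?f ` UNIV = carrier_vec 2"
    by (intro card_subset_eq) (auto simp: card_image card_carrier_vec card_ext)
  then show ?thesis using assms by (metis (no_types, lifting) imageE)
qed

lemma first_col_surj:
  assumes "a \<in> carrier_vec 2"
  shows "\<exists>y. a = vec 2 (\<lambda>b. \<phi> y $$ (b, 0))"
proof -
  let ?f = "\<lambda>y. vec 2 (\<lambda>b. \<phi> y $$ (b, 0))"
  have "inj ?f"
  proof (rule injI)
    fix x y assume eq: "?f x = ?f y"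
    have "\<phi> (x - y) $$ (b, 0) = 0" if "b < 2" for b
      using that arg_cong[OF eq, of "\<lambda>v. v $ b"] by (simp add: entry_diff)
    then have "lin (z * (x - y)) = 0" for z by (simp add: lin_def entry_mult)
    then show "x = y" using lin_nondegenerate[of "x - y"] by simp
  qed
  then have "?f ` UNIV = carrier_vec 2"
    by (intro card_subset_eq) (auto simp: card_image card_carrier_vec card_ext)
  then show ?thesis using assms by (metis (no_types, lifting) imageE)
qed

section \<open>Coordinates over the base field, and the lines in them\<close>

definition expand_row :: "'b vec \<Rightarrow> 'a vec" where
  "expand_row v = vec (2 * dim_vec v) (\<lambda>s. \<phi> (v $ (s div 2)) $$ (0, s mod 2))"

definition expand_col :: "'b vec \<Rightarrow> 'a vec" where
  "expand_col x = vec (2 * dim_vec x) (\<lambda>s. \<phi> (x $ (s div 2)) $$ (s mod 2, 0))"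

lemma expand_row_carrier: "v \<in> carrier_vec t \<Longrightarrow> expand_row v \<in> carrier_vec (2 * t)"
  and expand_col_carrier: "v \<in> carrier_vec t \<Longrightarrow> expand_col v \<in> carrier_vec (2 * t)"
  by (auto simp: expand_row_def expand_col_def)

lemma expand_row_scale: "expand_row (\<iota> a \<cdot>\<^sub>v v) = a \<cdot>\<^sub>v expand_row v"
  and expand_col_scale: "expand_col (\<iota> a \<cdot>\<^sub>v v) = a \<cdot>\<^sub>v expand_col v"
  by (auto simp: expand_row_def expand_col_def entry_scale less_mult_imp_div_less mult.commute
      intro!: eq_vecI)

text \<open>Each block of two coordinates multiplies the first row of \<open>\<phi> (v $ r)\<close>
  by the first column of \<open>\<phi> (x $ r)\<close>, which is the upper left entry of
  \<open>\<phi> (v $ r * x $ r)\<close>.\<close>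

lemma scalar_prod_expand:
  assumes v: "v \<in> carrier_vec t" and x: "x \<in> carrier_vec t"
  shows "expand_row v \<bullet> expand_col x = lin (v \<bullet> x)"
proof -
  have pairs: "(\<Sum>s\<in>{0..<2 * t}. f s) = (\<Sum>r\<in>{0..<t}. f (2 * r) + f (2 * r + 1))"
    for f :: "nat \<Rightarrow> 'a" and t
    by (induction t) (simp_all add: add.assoc)
  show ?thesis
    using v x
    by (simp add: scalar_prod_def expand_row_def expand_col_def pairs lin_sum)
      (simp add: lin_def entry_mult)
qed

lemma expand_col_surj:
  assumes u: "u \<in> carrier_vec (2 * t)"
  shows "\<exists>x\<in>carrier_vec t. u = expand_col x"
proof -
  have "\<exists>y. vec 2 (\<lambda>b. u $ (2 * r + b)) = vec 2 (\<lambda>b. \<phi> y $$ (b, 0))" for r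
    by (rule first_col_surj) simp
  then obtain y where y: "\<And>r. vec 2 (\<lambda>b. u $ (2 * r + b)) = vec 2 (\<lambda>b. \<phi> (y r) $$ (b, 0))"
    by metis
  have yb: "u $ (2 * r + b) = \<phi> (y r) $$ (b, 0)" if "b < 2" for r b
    using arg_cong[OF y[of r], of "\<lambda>v. v $ b"] that by simp
  have "u $ s = \<phi> (y (s div 2)) $$ (s mod 2, 0)" for s
    using yb[of "s mod 2" "s div 2"] by simp
  then have "u = expand_col (vec t y)"
    using u by (intro eq_vecI) (auto simp: expand_col_def less_mult_imp_div_less mult.commute)
  then show ?thesis by (intro bexI[of _ "vec t y"]) auto
qed

text \<open>Pairing with the expansions of all multiples of a unit vector isolates one entry, where
  nondegeneracy of \<open>lin\<close> applies.\<close>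

lemma expand_row_inj:
  assumes v: "v \<in> carrier_vec t" and w: "w \<in> carrier_vec t" and eq: "expand_row v = expand_row w"
  shows "v = w"
proof (rule eq_vecI)
  fix r assume "r < dim_vec w"
  then have r: "r < t" using w by simp
  have "lin (v $ r * z) = lin (w $ r * z)" for z
    using arg_cong[OF eq, of "\<lambda>u. u \<bullet> expand_col (z \<cdot>\<^sub>v unit_vec t r)"] v w r
    by (simp add: scalar_prod_expand mult.commute)
  then have "lin (z * (v $ r - w $ r)) = 0" for z
    by (simp add: lin_diff right_diff_distrib mult.commute)
  then show "v $ r = w $ r" using lin_nondegenerate[of "v $ r - w $ r"] by simp
qed (use v w in auto)

text \<open>The coefficient vector of a combination of the two rows is the first row of some
  \<open>\<phi> z\<close>; by multiplicativity the combination consists of the first rows of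
  \<open>\<phi> (z * v $ r)\<close>.\<close>

lemma row_space_block_row:
  assumes v: "v \<in> carrier_vec t"
  shows "vec_space.row_space (2 * t) (block_row \<phi> v) = (\<lambda>z. expand_row (z \<cdot>\<^sub>v v)) ` UNIV"
proof -
  let ?R = "\<lambda>z. vec 2 (\<lambda>b. \<phi> z $$ (0, b))"
  have A: "block_row \<phi> v \<in> carrier_mat 2 (2 * t)" using v by (simp add: block_row_def)
  have "(block_row \<phi> v)\<^sup>T *\<^sub>v ?R z = expand_row (z \<cdot>\<^sub>v v)" for z
    using v
    by (intro eq_vecI) (auto simp: block_row_def expand_row_def scalar_prod_def entry_mult
        less_mult_imp_div_less numeral_2_eq_2 mult.commute)
  moreover have "carrier_vec 2 = range ?R" using first_row_surj by auto
  ultimately have "(\<lambda>a. (block_row \<phi> v)\<^sup>T *\<^sub>v a) ` carrier_vec 2 = (\<lambda>z. expand_row (z \<cdot>\<^sub>v v)) ` UNIV"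
    by (simp add: image_image)
  moreover have "vec_space.row_space (2 * t) (block_row \<phi> v) = (\<lambda>a. (block_row \<phi> v)\<^sup>T *\<^sub>v a) ` carrier_vec 2"
    using vec_space.row_space_eq[OF A] A by (auto intro!: carrier_vecI)
  ultimately show ?thesis by simp
qed

text \<open>The chosen representative is \<open>a \<cdot>\<^sub>v v\<close> with
  \<open>a \<noteq> 0\<close>, and \<open>z \<mapsto> z * a\<close> permutes the extension, so the
  choice has no effect.\<close>

lemma field_reduction_proj_point:
  assumes v: "v \<in> carrier_vec t" and v0: "v \<noteq> 0\<^sub>v t"
  shows "field_reduction \<phi> (proj_point v) = (\<lambda>z. expand_row (z \<cdot>\<^sub>v v)) ` UNIV"
proof -
  define w where "w = (SOME w. w \<in> proj_point v \<and> w \<noteq> 0\<^sub>v (dim_vec w))"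
  have "1 \<cdot>\<^sub>v v \<in> proj_point v" unfolding proj_point_def by (rule rangeI)
  then have "v \<in> proj_point v \<and> v \<noteq> 0\<^sub>v (dim_vec v)" using v v0 by simp
  then have w: "w \<in> proj_point v" "w \<noteq> 0\<^sub>v (dim_vec w)"
    unfolding w_def by (metis (mono_tags, lifting) someI)+
  then obtain a where a: "w = a \<cdot>\<^sub>v v" unfolding proj_point_def by blast
  have a0: "a \<noteq> 0" using w(2) v by (auto simp: a)
  have wt: "w \<in> carrier_vec t" using v a by simp
  have "field_reduction \<phi> (proj_point v) = (\<lambda>z. expand_row ((z * a) \<cdot>\<^sub>v v)) ` UNIV"
    using row_space_block_row[OF wt] wt
    by (simp add: field_reduction_def flip: w_def) (simp add: a smult_smult_assoc)
  also have "\<dots> = (\<lambda>z. expand_row (z \<cdot>\<^sub>v v)) ` range (\<lambda>z. z * a)" by (simp add: image_image)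
  also have "range (\<lambda>z. z * a) = UNIV" using a0 by (intro surjI[of _ "\<lambda>z. z / a"]) simp
  finally show ?thesis .
qed

end

section \<open>Representatives of the points\<close>

text \<open>The pair \<open>(l, l)\<close> stands for \<open>P\<^sub>l\<close>; for \<open>l < m\<close>, the pair \<open>(l, m)\<close> stands for the first and
  \<open>(m, l)\<close> for the second of the two points \<open>Q\<close> on the line through \<open>P\<^sub>l\<close> and \<open>P\<^sub>m\<close>.\<close>

definition pair_vec :: "nat \<Rightarrow> (nat \<Rightarrow> nat \<Rightarrow> 'b::field) \<Rightarrow> (nat \<Rightarrow> nat \<Rightarrow> 'b) \<Rightarrow> nat \<times> nat \<Rightarrow> 'b vec" where
  "pair_vec t \<alpha> \<beta> = (\<lambda>(l, m).
     if l = m then unit_vec t l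
     else if l < m then unit_vec t l + \<alpha> l m \<cdot>\<^sub>v unit_vec t m
     else unit_vec t m + \<beta> m l \<cdot>\<^sub>v unit_vec t l)"

lemma pair_vec_carrier: "pair_vec t \<alpha> \<beta> p \<in> carrier_vec t"
  by (auto simp: pair_vec_def split: prod.split)

lemma dim_pair_vec [simp]: "dim_vec (pair_vec t \<alpha> \<beta> p) = t"
  using pair_vec_carrier by (rule carrier_vecD)

lemma pair_vec_index:
  "r < t \<Longrightarrow> l < t \<Longrightarrow> m < t \<Longrightarrow> pair_vec t \<alpha> \<beta> (l, m) $ r =
    (if r = min l m then 1 else if r = max l m then (if l < m then \<alpha> l m else \<beta> m l) else 0)"
  by (auto simp: pair_vec_def)

lemma pair_vec_scalar_prod:
  assumes "x \<in> carrier_vec t" "l < t" "m < t"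
  shows "pair_vec t \<alpha> \<beta> (l, m) \<bullet> x =
    (if l = m then x $ l else if l < m then x $ l + \<alpha> l m * x $ m else x $ m + \<beta> m l * x $ l)"
  using assms by (simp add: pair_vec_def add_scalar_prod_distrib[where n = t])

text \<open>The support reveals the unordered pair of indices, the entry at the smaller index is the
  scalar, and the entry at the larger one tells the two slopes apart.\<close>

lemma smult_pair_vec_inj:
  assumes nz: "\<And>l m. l < m \<Longrightarrow> m < t \<Longrightarrow> \<alpha> l m \<noteq> 0 \<and> \<beta> l m \<noteq> 0 \<and> \<alpha> l m \<noteq> \<beta> l m"
    and p: "p \<in> {..<t} \<times> {..<t}" "p' \<in> {..<t} \<times> {..<t}" and z: "z \<noteq> 0" "z' \<noteq> 0"
    and eq: "z \<cdot>\<^sub>v pair_vec t \<alpha> \<beta> p = z' \<cdot>\<^sub>v pair_vec t \<alpha> \<beta> p'"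
  shows "p = p' \<and> z = z'"
proof -
  obtain l m l' m' where [simp]: "p = (l, m)" "p' = (l', m')" by (cases p, cases p')
  have lt: "l < t" "m < t" "l' < t" "m' < t" using p by auto
  have E: "z * pair_vec t \<alpha> \<beta> (l, m) $ r = z' * pair_vec t \<alpha> \<beta> (l', m') $ r" if "r < t" for r
    using arg_cong[OF eq, of "\<lambda>v. v $ r"] that by simp
  have supp: "pair_vec t \<alpha> \<beta> (a, b) $ r \<noteq> 0 \<longleftrightarrow> r \<in> {min a b, max a b}" if "r < t" "a < t" "b < t" for r a b
    using that nz by (auto simp: pair_vec_index min_def max_def)
  have "r \<in> {min l m, max l m} \<longleftrightarrow> r \<in> {min l' m', max l' m'}" if "r < t" for r
    using E[OF that] supp[OF that] z lt by (metis mult_eq_0_iff)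
  moreover have "{min l m, max l m} \<subseteq> {..<t}" "{min l' m', max l' m'} \<subseteq> {..<t}" using lt by auto
  ultimately have "{min l m, max l m} = {min l' m', max l' m'}" by blast
  moreover have "min l m \<le> max l m" "min l' m' \<le> max l' m'" by simp_all
  ultimately have mm: "min l m = min l' m'" "max l m = max l' m'"
    by (metis doubleton_eq_iff le_antisym)+
  have "z = z'" using E[of "min l m"] lt mm by (simp add: pair_vec_index)
  moreover have "l < m \<longleftrightarrow> l' < m'" if "l \<noteq> m"
  proof -
    have "(if l < m then \<alpha> l m else \<beta> m l) = (if l' < m' then \<alpha> l' m' else \<beta> m' l')"
      using E[of "max l m"] \<open>z = z'\<close> z lt mm that by (auto simp: pair_vec_index)
    then show ?thesis using mm that lt nz[of l m] nz[of m l] by (auto simp: min_def max_def split: if_splits)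
  qed
  ultimately show ?thesis using mm by (auto simp: min_def max_def split: if_splits)
qed

section \<open>How many of the points avoid a hyperplane\<close>

lemma card_pair_vec_nonorthogonal:
  assumes ne: "\<And>l m. l < m \<Longrightarrow> m < t \<Longrightarrow> \<alpha> l m \<noteq> 0 \<and> \<beta> l m \<noteq> 0 \<and> \<alpha> l m \<noteq> \<beta> l m"
    and x: "x \<in> carrier_vec t" "x \<noteq> 0\<^sub>v t"
  shows "2 * t - 1 \<le> card {p \<in> {..<t} \<times> {..<t}. pair_vec t \<alpha> \<beta> p \<bullet> x \<noteq> 0}" (is "_ \<le> card ?N")
proof -
  obtain l where l: "l < t" "x $ l \<noteq> 0"
    using x by (metis carrier_vecD eq_vecI index_zero_vec)
  note prod = pair_vec_scalar_prod[OF x(1)]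
  \<comment> \<open>For \<open>m = l\<close> the three pairs coincide. The sets for different
    \<open>m\<close> are disjoint, so their sizes add up.\<close>
  define A where "A m = {(l, m), (m, l), (m, m)} \<inter> ?N" for m
  have ge: "(if m = l then 1 else 2) \<le> card (A m)" if m: "m < t" for m
  proof (cases "m = l")
    case True
    then have "A m = {(l, l)}" using l by (auto simp: A_def prod)
    then show ?thesis using True by simp
  next
    case ml: False
    have fin: "finite (A m)" by (simp add: A_def)
    have two: "2 \<le> card (A m)" if "a \<in> A m" "b \<in> A m" "a \<noteq> b" for a b
      using card_mono[OF fin, of "{a, b}"] that by simp
    have "2 \<le> card (A m)"
    proof (cases "x $ m = 0")
      case True
      \<comment> \<open>With \<open>x $ m = 0\<close> both scalar products are nonzero multiples of
        \<open>x $ l\<close>.\<close>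
      then have "(l, m) \<in> A m" "(m, l) \<in> A m"
        using l m ml ne[of l m] ne[of m l] by (auto simp: A_def prod)
      then show ?thesis using two ml by blast
    next
      case False
      then have mm: "(m, m) \<in> A m" using m by (simp add: A_def prod)
      \<comment> \<open>If both products were zero, subtracting them would leave the difference of
        the slopes times a nonzero entry of \<open>x\<close>.\<close>
      have "(l, m) \<in> A m \<or> (m, l) \<in> A m"
      proof (rule ccontr)
        assume "\<not> ((l, m) \<in> A m \<or> (m, l) \<in> A m)"
        then have z: "pair_vec t \<alpha> \<beta> (l, m) \<bullet> x = 0" "pair_vec t \<alpha> \<beta> (m, l) \<bullet> x = 0"
          using l m by (auto simp: A_def)
        show False
        proof (cases "l < m")
          case True
          then have "x $ l + \<alpha> l m * x $ m = x $ l + \<beta> l m * x $ m"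
            using z l m by (simp add: prod)
          then show False using False True ne m by simp
        next
          case nl: False
          then have "m < l" using ml by simp
          then have "x $ m + \<alpha> m l * x $ l = x $ m + \<beta> m l * x $ l"
            using z l m by (simp add: prod)
          then show False using l ne \<open>m < l\<close> by simp
        qed
      qed
      then show ?thesis using two mm ml by blast
    qed
    then show ?thesis using ml by simp
  qed
  \<comment> \<open>Adding 1 at \<open>m = l\<close> makes every summand 2.\<close>
  have "(\<Sum>m<t. (if m = l then 1 else 2) + (if m = l then 1 else 0)) = (\<Sum>m<t. 2 :: nat)"
    by (rule sum.cong) auto
  then have "2 * t - 1 = (\<Sum>m<t. if m = l then 1 else 2)"
    using l by (simp add: sum.distrib)
  also have "\<dots> \<le> (\<Sum>m<t. card (A m))" by (intro sum_mono ge) simp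
  also have "\<dots> = card (\<Union>m<t. A m)"
    by (rule card_UN_disjoint[symmetric]) (auto simp: A_def)
  also have "\<dots> \<le> card ?N" by (intro card_mono) (auto simp: A_def)
  finally show ?thesis .
qed

text \<open>Index 0 is always the smaller one of its pair, so the entry there is 1 whatever the
  slopes are. The pairs containing 0 form a row and a column sharing \<open>(0, 0)\<close>.\<close>

lemma card_pair_vec_nonorthogonal_unit_vec:
  assumes "t \<ge> 1"
  shows "card {p \<in> {..<t} \<times> {..<t}. pair_vec t \<alpha> \<beta> p \<bullet> unit_vec t 0 \<noteq> 0} = 2 * t - 1"
proof -
  have "{p \<in> {..<t} \<times> {..<t}. pair_vec t \<alpha> \<beta> p \<bullet> unit_vec t 0 \<noteq> 0} = {0} \<times> {..<t} \<union> {..<t} \<times> {0}"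
    using assms by (auto simp: pair_vec_index split: if_splits)
  moreover have "({0} \<times> {..<t}) \<inter> ({..<t} \<times> {0}) = {(0, 0 :: nat)}" using assms by auto
  ultimately show ?thesis
    using card_Un_Int[of "{0 :: nat} \<times> {..<t}" "{..<t} \<times> {0 :: nat}"] by simp
qed

section \<open>From proportional values to proportional vectors\<close>

lemma (in field_hom) pair_vec_proportional:
  fixes \<alpha> \<beta> :: "nat \<Rightarrow> nat \<Rightarrow> 'b"
  assumes \<alpha>: "\<And>l m. l < m \<Longrightarrow> m < t \<Longrightarrow> \<alpha> l m \<noteq> 0"
    and ratio: "\<And>l m c. l < m \<Longrightarrow> m < t \<Longrightarrow> \<beta> l m \<noteq> hom c * \<alpha> l m"
    and x: "x \<in> carrier_vec t" and y: "y \<in> carrier_vec t"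
    and proportional: "\<And>p. p \<in> {..<t} \<times> {..<t} \<Longrightarrow>
      \<exists>c. pair_vec t \<alpha> \<beta> p \<bullet> y = hom c * (pair_vec t \<alpha> \<beta> p \<bullet> x)"
  shows "\<exists>c. y = hom c \<cdot>\<^sub>v x"
proof (cases "x = 0\<^sub>v t")
  case True
  have "y $ l = 0" if "l < t" for l
    using proportional[of "(l, l)"] that x y by (auto simp: pair_vec_scalar_prod True)
  then have "y = hom 0 \<cdot>\<^sub>v x" using x y by (intro eq_vecI) auto
  then show ?thesis ..
next
  case False
  then obtain k where k: "k < t" "x $ k \<noteq> 0"
    using x by (metis carrier_vecD eq_vecI index_zero_vec)
  have "\<exists>c. y $ l = hom c * x $ l" if "l < t" for l
    using proportional[of "(l, l)"] that x y by (simp add: pair_vec_scalar_prod)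
  then obtain c where c: "\<And>l. l < t \<Longrightarrow> y $ l = hom (c l) * x $ l" by metis
  have eq: "c l = c m" if lm: "l < m" "m < t" and nz: "x $ l \<noteq> 0" "x $ m \<noteq> 0" for l m
  proof (rule ccontr)
    assume ne: "c l \<noteq> c m"
    have lt: "l < t" using lm by simp
    obtain d where "y $ l + \<alpha> l m * y $ m = hom d * (x $ l + \<alpha> l m * x $ m)"
      using proportional[of "(l, m)"] lm lt x y by (auto simp: pair_vec_scalar_prod)
    then have d: "hom (c l - d) * x $ l = \<alpha> l m * hom (d - c m) * x $ m"
      by (simp add: c lm lt hom_minus algebra_simps)
    obtain e where "y $ l + \<beta> l m * y $ m = hom e * (x $ l + \<beta> l m * x $ m)"
      using proportional[of "(m, l)"] lm lt x y by (auto simp: pair_vec_scalar_prod)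
    then have e: "hom (c l - e) * x $ l = \<beta> l m * hom (e - c m) * x $ m"
      by (simp add: c lm lt hom_minus algebra_simps)
    have \<beta>0: "\<beta> l m \<noteq> 0" using ratio[OF lm, of 0] by simp
    \<comment> \<open>These two differences form the denominator below. If either vanished, one of
      the equations \<open>d\<close>, \<open>e\<close> would force \<open>c l = c m\<close>.\<close>
    have cd: "c l \<noteq> d" using d ne nz \<alpha>[OF lm] by auto
    have ec: "e \<noteq> c m" using e ne nz by auto
    \<comment> \<open>Multiplying \<open>e\<close> by the factor from \<open>d\<close> eliminates
      \<open>x $ l\<close>; cancelling \<open>x $ m\<close> then expresses the ratio of the slopes
      in the base field.\<close>
    have "\<beta> l m * hom (e - c m) * hom (c l - d) * x $ m = hom (c l - e) * (hom (c l - d) * x $ l)"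
      using e by (simp add: ac_simps)
    also have "\<dots> = hom (c l - e) * hom (d - c m) * \<alpha> l m * x $ m"
      using d by (simp add: ac_simps)
    finally have "\<beta> l m * hom ((e - c m) * (c l - d)) = hom ((c l - e) * (d - c m)) * \<alpha> l m"
      using nz by (simp add: hom_mult ac_simps)
    then have "\<beta> l m = hom ((c l - e) * (d - c m)) * \<alpha> l m / hom ((e - c m) * (c l - d))"
      using cd ec by (intro nonzero_eq_divide_eq[THEN iffD2]) simp_all
    also have "\<dots> = hom ((c l - e) * (d - c m) / ((e - c m) * (c l - d))) * \<alpha> l m"
      by (simp only: hom_div times_divide_eq_left)
    finally show False using ratio[OF lm] by blast
  qed
  \<comment> \<open>Where \<open>x $ l\<close> vanishes so does \<open>y $ l\<close>, and any factor
    fits; elsewhere the factor agrees with the one at \<open>k\<close>.\<close>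
  have "y $ l = hom (c k) * x $ l" if l: "l < t" for l
  proof (cases "x $ l = 0 \<or> l = k")
    case True
    then show ?thesis using c l by auto
  next
    case False
    then have "c l = c k" using eq[of l k] eq[of k l] k l by (metis linorder_neqE_nat)
    then show ?thesis using c l by simp
  qed
  then have "y = hom (c k) \<cdot>\<^sub>v x" using x y by (intro eq_vecI) auto
  then show ?thesis ..
qed

section \<open>The code\<close>

text \<open>Indexing by a square turns the \<open>t\<^sup>2\<close> lines into one family that can
  be counted and summed uniformly.\<close>

lemma code_lines_eq:
  "code_lines \<phi> \<gamma> t i j =
    (\<lambda>p. field_reduction \<phi> (proj_point (pair_vec t (\<lambda>l m. \<gamma> ^ i l m) (\<lambda>l m. \<gamma> ^ j l m) p))) `
      ({..<t} \<times> {..<t})"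
proof -
  define F where
    "F = (\<lambda>p. field_reduction \<phi> (proj_point (pair_vec t (\<lambda>l m. \<gamma> ^ i l m) (\<lambda>l m. \<gamma> ^ j l m) p)))"
  have P: "field_reduction \<phi> (point_P t l) = F (l, l)" for l
    by (simp add: F_def point_P_def pair_vec_def)
  have Q: "field_reduction \<phi> (point_Q \<gamma> t l m (i l m)) = F (l, m)"
    "field_reduction \<phi> (point_Q \<gamma> t l m (j l m)) = F (m, l)" if "l < m" for l m
    using that by (simp_all add: F_def point_Q_def pair_vec_def)
  have "code_lines \<phi> \<gamma> t i j = {F (l, l) | l. l < t} \<union> {F (l, m) | l m. l < m \<and> m < t} \<union>
      {F (m, l) | l m. l < m \<and> m < t}"
    unfolding code_lines_def by (simp add: P Q cong: rev_conj_cong)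
  also have "\<dots> = F ` ({(l, l) | l. l < t} \<union> {(l, m) | l m. l < m \<and> m < t} \<union> {(m, l) | l m. l < m \<and> m < t})"
    unfolding image_Un by (intro arg_cong2[of _ _ _ _ "(\<union>)"]) (simp_all add: image_Collect, blast+)
  also have "{(l, l) | l. l < t} \<union> {(l, m) | l m. l < m \<and> m < t} \<union> {(m, l) | l m. l < m \<and> m < t}
      = {..<t} \<times> {..<t}"
    by (auto simp: neq_iff)
  finally show ?thesis unfolding F_def .
qed

lemma UN_image_eq: "(\<Union>p\<in>A. (\<lambda>z. f p z) ` B) = (\<lambda>(p, z). f p z) ` (A \<times> B)"
  by auto

text \<open>The slopes stand for the powers of the primitive element; \<open>ratio\<close> is the
  form in which the condition on the exponents enters.\<close>

locale projective_system_code = quadratic_matrix_rep \<iota> \<phi>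
  for \<iota> :: "'a::{field,finite} \<Rightarrow> 'b::{field,finite}" and \<phi> :: "'b \<Rightarrow> 'a mat" +
  fixes t :: nat and \<alpha> \<beta> :: "nat \<Rightarrow> nat \<Rightarrow> 'b" and G :: "'a mat"
  assumes t: "t \<ge> 1"
    and \<alpha>: "\<And>l m. l < m \<Longrightarrow> m < t \<Longrightarrow> \<alpha> l m \<noteq> 0"
    and ratio: "\<And>l m c. l < m \<Longrightarrow> m < t \<Longrightarrow> \<beta> l m \<noteq> \<iota> c * \<alpha> l m"
    and dim_row_G: "dim_row G = 2 * t"
    and columns: "columns_represent G
      (\<Union>p\<in>{..<t} \<times> {..<t}. points_of (field_reduction \<phi> (proj_point (pair_vec t \<alpha> \<beta> p))))"
begin

section \<open>The vectors on the lines and their count\<close>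

abbreviation "I \<equiv> {..<t} \<times> {..<t}"

abbreviation "pv \<equiv> pair_vec t \<alpha> \<beta>"

text \<open>All representatives of all points on the lines, so that the choice made by the columns
  of \<open>G\<close> disappears.\<close>

definition W :: "'a vec set" where
  "W = (\<lambda>(p, z). expand_row (z \<cdot>\<^sub>v pv p)) ` (I \<times> (UNIV - {0}))"

lemma distinct_slopes: "l < m \<Longrightarrow> m < t \<Longrightarrow> \<alpha> l m \<noteq> 0 \<and> \<beta> l m \<noteq> 0 \<and> \<alpha> l m \<noteq> \<beta> l m"
  using \<alpha>[of l m] ratio[of l m 0] ratio[of l m 1] by auto

lemma pv_carrier [simp]: "pv p \<in> carrier_vec t"
  by (rule pair_vec_carrier)

text \<open>Besides the uniqueness of \<open>z\<close>, this contains the pairwise disjointness of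
  the lines.\<close>

lemma inj_on_W: "inj_on (\<lambda>(p, z). expand_row (z \<cdot>\<^sub>v pv p)) (I \<times> (UNIV - {0}))"
proof (rule inj_onI)
  fix a b assume ab: "a \<in> I \<times> (UNIV - {0})" "b \<in> I \<times> (UNIV - {0})"
    "(case a of (p, z) \<Rightarrow> expand_row (z \<cdot>\<^sub>v pv p)) = (case b of (p, z) \<Rightarrow> expand_row (z \<cdot>\<^sub>v pv p))"
  obtain p z p' z' where [simp]: "a = (p, z)" "b = (p', z')" by (cases a, cases b)
  have "z \<cdot>\<^sub>v pv p = z' \<cdot>\<^sub>v pv p'"
    using ab by (intro expand_row_inj[of _ t]) auto
  then show "a = b" using smult_pair_vec_inj[OF distinct_slopes, where p = p and p' = p' and z = z and z' = z'] ab by simp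
qed

lemma smult_pv_nonzero:
  assumes "p \<in> I" "z \<noteq> 0"
  shows "z \<cdot>\<^sub>v pv p \<noteq> 0\<^sub>v t"
proof
  obtain l m where p: "p = (l, m)" "l < t" "m < t" using assms(1) by auto
  assume "z \<cdot>\<^sub>v pv p = 0\<^sub>v t"
  from arg_cong[OF this, of "\<lambda>v. v $ min l m"] show False
    using p assms(2) by (simp add: pair_vec_index)
qed

lemma expand_row_zero: "expand_row (0\<^sub>v t) = 0\<^sub>v (2 * t)"
proof -
  have "expand_row (\<iota> 0 \<cdot>\<^sub>v 0\<^sub>v t) = 0 \<cdot>\<^sub>v expand_row (0\<^sub>v t)" by (rule expand_row_scale)
  then show ?thesis
    using zero_smult_vec[OF expand_row_carrier[of "0\<^sub>v t" t]] by (simp add: zero_smult_vec[of _ t])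
qed

lemma expand_row_eq_zero_iff: "v \<in> carrier_vec t \<Longrightarrow> expand_row v = 0\<^sub>v (2 * t) \<longleftrightarrow> v = 0\<^sub>v t"
  using expand_row_inj[of v t "0\<^sub>v t"] by (auto simp: expand_row_zero)

lemma W_subset: "W \<subseteq> carrier_vec (dim_row G) - {0\<^sub>v (dim_row G)}"
  using smult_pv_nonzero
  by (auto simp: W_def dim_row_G expand_row_eq_zero_iff intro!: expand_row_carrier)

lemma W_scale:
  assumes "a \<noteq> 0" "w \<in> W"
  shows "a \<cdot>\<^sub>v w \<in> W"
proof -
  obtain p z where pz: "p \<in> I" "z \<noteq> 0" "w = expand_row (z \<cdot>\<^sub>v pv p)"
    using assms(2) by (auto simp: W_def)
  have "a \<cdot>\<^sub>v w = expand_row ((\<iota> a * z) \<cdot>\<^sub>v pv p)"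
    unfolding pz(3) by (simp only: smult_smult_assoc[symmetric] expand_row_scale)
  moreover have "\<iota> a * z \<noteq> 0" using assms(1) pz(2) by simp
  ultimately show ?thesis
    unfolding W_def using pz(1) by (intro image_eqI[of _ _ "(p, \<iota> a * z)"]) auto
qed

lemma columns_represent_W: "columns_represent G (proj_point ` W)"
proof -
  have "points_of (field_reduction \<phi> (proj_point (pv p)))
      = (\<lambda>z. proj_point (expand_row (z \<cdot>\<^sub>v pv p))) ` (UNIV - {0})" if "p \<in> I" for p
  proof -
    let ?e = "\<lambda>z. expand_row (z \<cdot>\<^sub>v pv p)"
    have dim: "dim_vec (?e z) = 2 * t" for z
      using expand_row_carrier[of "z \<cdot>\<^sub>v pv p" t] by simp
    have zero: "?e z = 0\<^sub>v (2 * t) \<longleftrightarrow> z = 0" for z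
      using smult_pv_nonzero[OF that, of z] by (auto simp: expand_row_eq_zero_iff)
    have "pv p \<noteq> 0\<^sub>v t" using smult_pv_nonzero[OF that, of 1] by simp
    then have "field_reduction \<phi> (proj_point (pv p)) = range ?e"
      by (intro field_reduction_proj_point[of _ t]) simp_all
    moreover have "points_of (range ?e) = proj_point ` {v \<in> range ?e. v \<noteq> 0\<^sub>v (dim_vec v)}"
      unfolding points_of_def by (rule setcompr_eq_image)
    moreover have "{v \<in> range ?e. v \<noteq> 0\<^sub>v (dim_vec v)} = ?e ` (UNIV - {0})"
      by (auto simp: dim zero)
    ultimately show ?thesis by (simp only: image_image)
  qed
  then have "(\<Union>p\<in>I. points_of (field_reduction \<phi> (proj_point (pv p))))
      = (\<Union>p\<in>I. (\<lambda>z. proj_point (expand_row (z \<cdot>\<^sub>v pv p))) ` (UNIV - {0}))"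
    by (intro SUP_cong refl)
  also have "\<dots> = (\<lambda>(p, z). proj_point (expand_row (z \<cdot>\<^sub>v pv p))) ` (I \<times> (UNIV - {0}))"
    by (rule UN_image_eq)
  also have "\<dots> = proj_point ` W"
    by (simp only: W_def image_image case_prod_unfold)
  finally show ?thesis using columns by simp
qed

text \<open>A property invariant under nonzero scalars does not see which representatives were
  chosen. By \<open>inj_on_W\<close> the vectors can then be counted line by line.\<close>

lemma card_columns:
  assumes "\<And>a w. a \<noteq> 0 \<Longrightarrow> w \<in> carrier_vec (dim_row G) \<Longrightarrow> P (a \<cdot>\<^sub>v w) \<longleftrightarrow> P w"
  shows "card {c. c < dim_col G \<and> P (col G c)} * (CARD('a) - 1) =
    (\<Sum>p\<in>I. card {z. z \<noteq> 0 \<and> P (expand_row (z \<cdot>\<^sub>v pv p))})"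
proof -
  have "card {c. c < dim_col G \<and> P (col G c)} * (CARD('a) - 1) = card {w \<in> W. P w}"
    by (rule card_columns_represent[OF columns_represent_W W_subset W_scale assms])
  also have "{w \<in> W. P w} = (\<lambda>(p, z). expand_row (z \<cdot>\<^sub>v pv p)) `
      (SIGMA p:I. {z. z \<noteq> 0 \<and> P (expand_row (z \<cdot>\<^sub>v pv p))})" (is "_ = ?f ` ?S")
    unfolding W_def by auto
  also have "card \<dots> = card ?S"
    by (intro card_image inj_on_subset[OF inj_on_W]) auto
  also have "\<dots> = (\<Sum>p\<in>I. card {z. z \<noteq> 0 \<and> P (expand_row (z \<cdot>\<^sub>v pv p))})"
    by (intro card_SigmaI) auto
  finally show ?thesis .
qed

section \<open>Length, weights and dimension\<close>

lemma length_code: "dim_col G = (CARD('a) + 1) * t\<^sup>2"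
proof -
  let ?q = "CARD('a)"
  have q: "2 \<le> ?q" by (rule two_le_card_field)
  have "{z :: 'b. z \<noteq> 0} = UNIV - {0}" by auto
  \<comment> \<open>The property that always holds counts all columns, and each line contributes its
    \<open>q\<^sup>2 - 1\<close> nonzero vectors.\<close>
  then have "dim_col G * (?q - 1) = t * t * (?q\<^sup>2 - 1)"
    using card_columns[of "\<lambda>_. True"] by (simp add: card_Diff_subset card_ext)
  also have "?q\<^sup>2 - 1 = (?q + 1) * (?q - 1)"
    using q by (simp add: power2_eq_square algebra_simps diff_mult_distrib2)
  finally have "dim_col G * (?q - 1) = (?q + 1) * t\<^sup>2 * (?q - 1)"
    by (simp only: power2_eq_square ac_simps)
  then show ?thesis using q by simp
qed

lemma support_codeword:
  "support (G\<^sup>T *\<^sub>v u) = {c. c < dim_col G \<and> col G c \<bullet> u \<noteq> 0}"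
  by (auto simp: support_def)

lemma expand_row_orthogonal_iff:
  assumes "x \<in> carrier_vec t"
  shows "expand_row (z \<cdot>\<^sub>v pv p) \<bullet> expand_col x = lin (z * (pv p \<bullet> x))"
  using assms by (simp add: scalar_prod_expand[of _ t] smult_scalar_prod_distrib[of _ t])

lemma weight_codeword:
  assumes x: "x \<in> carrier_vec t"
  shows "weight (G\<^sup>T *\<^sub>v expand_col x) = CARD('a) * card {p \<in> I. pv p \<bullet> x \<noteq> 0}"
proof -
  let ?q = "CARD('a)" and ?u = "expand_col x"
  have u: "?u \<in> carrier_vec (dim_row G)" using expand_col_carrier[OF x] dim_row_G by simp
  have "weight (G\<^sup>T *\<^sub>v ?u) * (?q - 1) = (\<Sum>p\<in>I. card {z. z \<noteq> 0 \<and> lin (z * (pv p \<bullet> x)) \<noteq> 0})"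
    unfolding weight_def support_codeword expand_row_orthogonal_iff[OF x, symmetric]
    by (rule card_columns) (use u in \<open>simp add: smult_scalar_prod_distrib\<close>)
  also have "\<dots> = (\<Sum>p\<in>I. if pv p \<bullet> x \<noteq> 0 then ?q * (?q - 1) else 0)"
    by (intro sum.cong) (simp_all add: card_lin_nonzero)
  also have "\<dots> = ?q * card {p \<in> I. pv p \<bullet> x \<noteq> 0} * (?q - 1)"
    by (simp flip: sum.inter_filter)
  finally show ?thesis using two_le_card_field[where 'a = 'a] by simp
qed

lemma codeword_cases:
  assumes "c \<in> generated_code G"
  obtains x where "x \<in> carrier_vec t" "c = G\<^sup>T *\<^sub>v expand_col x"
proof -
  obtain u where "u \<in> carrier_vec (2 * t)" "c = G\<^sup>T *\<^sub>v u"
    using assms unfolding generated_code_eq dim_row_G by (rule imageE)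
  then show thesis using expand_col_surj[of u t] that by auto
qed

lemma expand_col_zero: "expand_col (0\<^sub>v t) = 0\<^sub>v (2 * t)"
proof -
  have "expand_col (\<iota> 0 \<cdot>\<^sub>v 0\<^sub>v t) = 0 \<cdot>\<^sub>v expand_col (0\<^sub>v t)" by (rule expand_col_scale)
  then show ?thesis
    using zero_smult_vec[OF expand_col_carrier[of "0\<^sub>v t" t]] by (simp add: zero_smult_vec[of _ t])
qed

lemma weight_ge:
  assumes "x \<in> carrier_vec t" "x \<noteq> 0\<^sub>v t"
  shows "CARD('a) * (2 * t - 1) \<le> weight (G\<^sup>T *\<^sub>v expand_col x)"
  unfolding weight_codeword[OF assms(1)]
  by (intro mult_le_mono2 card_pair_vec_nonorthogonal[OF distinct_slopes] assms)

text \<open>The weight bound is positive as \<open>t \<ge> 1\<close>. This yields the injectivity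
  needed for the dimension.\<close>

lemma codeword_nonzero:
  assumes "x \<in> carrier_vec t" "x \<noteq> 0\<^sub>v t"
  shows "G\<^sup>T *\<^sub>v expand_col x \<noteq> 0\<^sub>v (dim_col G)"
proof
  assume "G\<^sup>T *\<^sub>v expand_col x = 0\<^sub>v (dim_col G)"
  then have "weight (G\<^sup>T *\<^sub>v expand_col x) = 0" by (simp add: weight_def support_def)
  then show False using weight_ge[OF assms] t two_le_card_field[where 'a = 'a] by simp
qed

lemma linear_code_generated:
  "linear_code (dim_col G) (2 * t) (CARD('a) * (2 * t - 1)) (generated_code G)"
  unfolding linear_code_def
proof (intro conjI ballI impI)
  show "VectorSpace.subspace class_ring (generated_code G) (module_vec TYPE('a) (dim_col G))"
    by (rule subspace_generated_code)
  show "vectorspace.dim class_ring ((module_vec TYPE('a) (dim_col G))\<lparr>carrier := generated_code G\<rparr>) = 2 * t"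
    unfolding dim_row_G[symmetric]
  proof (rule dim_generated_code)
    fix u assume "u \<in> carrier_vec (dim_row G)" "G\<^sup>T *\<^sub>v u = 0\<^sub>v (dim_col G)"
    then show "u = 0\<^sub>v (dim_row G)"
      using expand_col_surj codeword_nonzero unfolding dim_row_G by (metis expand_col_zero)
  qed
  have e: "unit_vec t 0 \<in> carrier_vec t" "unit_vec t 0 \<noteq> (0\<^sub>v t :: 'b vec)" using t by auto
  show "\<exists>c\<in>generated_code G. c \<noteq> 0\<^sub>v (dim_col G) \<and> weight c = CARD('a) * (2 * t - 1)"
  proof (intro bexI conjI)
    show "G\<^sup>T *\<^sub>v expand_col (unit_vec t 0) \<noteq> 0\<^sub>v (dim_col G)" by (rule codeword_nonzero[OF e])
    show "weight (G\<^sup>T *\<^sub>v expand_col (unit_vec t 0)) = CARD('a) * (2 * t - 1)"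
      by (simp only: weight_codeword[OF e(1)] card_pair_vec_nonorthogonal_unit_vec[OF t])
    show "G\<^sup>T *\<^sub>v expand_col (unit_vec t 0) \<in> generated_code G"
      unfolding generated_code_eq dim_row_G by (intro imageI expand_col_carrier e)
  qed
  fix c assume c: "c \<in> generated_code G" "c \<noteq> 0\<^sub>v (dim_col G)"
  obtain x where x: "x \<in> carrier_vec t" "c = G\<^sup>T *\<^sub>v expand_col x" using c(1) by (rule codeword_cases)
  have "x \<noteq> 0\<^sub>v t" using c(2) unfolding x(2) by (auto simp: expand_col_zero dim_row_G[symmetric])
  then show "CARD('a) * (2 * t - 1) \<le> weight c" unfolding x(2) by (intro weight_ge x)
qed

section \<open>Minimality\<close>

lemma minimal_code_generated: "minimal_code (generated_code G)"
  unfolding minimal_code_def minimal_codeword_def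
proof (intro ballI impI conjI)
  fix c c' assume c: "c \<in> generated_code G" "c' \<in> generated_code G" "support c' \<subseteq> support c"
  obtain x where x: "x \<in> carrier_vec t" "c = G\<^sup>T *\<^sub>v expand_col x" using c(1) by (rule codeword_cases)
  obtain y where y: "y \<in> carrier_vec t" "c' = G\<^sup>T *\<^sub>v expand_col y" using c(2) by (rule codeword_cases)
  have ux: "expand_col x \<in> carrier_vec (dim_row G)" and uy: "expand_col y \<in> carrier_vec (dim_row G)"
    using expand_col_carrier x y dim_row_G by auto
  \<comment> \<open>Inclusion of supports speaks of the columns only; it extends to \<open>W\<close>
    because every vector there is a multiple of a column.\<close>
  have ker: "w \<bullet> expand_col y = 0" if w: "w \<in> W" "w \<bullet> expand_col x = 0" for w
  proof -
    have "\<exists>a k. k < dim_col G \<and> w = a \<cdot>\<^sub>v col G k"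
      by (rule card_columns_represent(2)[OF columns_represent_W W_subset W_scale, of "\<lambda>_. True"])
        (use w in auto)
    then obtain a k where k: "k < dim_col G" "w = a \<cdot>\<^sub>v col G k" by blast
    show ?thesis
    proof (cases "a = 0")
      case True
      then show ?thesis using uy by (simp add: k(2) smult_scalar_prod_distrib[OF col_dim])
    next
      case False
      then have "k \<notin> support c"
        using w(2) ux by (simp add: k(2) x(2) support_codeword smult_scalar_prod_distrib[OF col_dim])
      then have "k \<notin> support c'" using c(3) by blast
      then show ?thesis
        using k uy by (simp add: y(2) support_codeword smult_scalar_prod_distrib[OF col_dim])
    qed
  qed
  have "\<exists>a. pv p \<bullet> y = \<iota> a * (pv p \<bullet> x)" if p: "p \<in> I" for p
  proof (rule lin_proportional)
    fix z assume z: "lin (z * (pv p \<bullet> x)) = 0"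
    show "lin (z * (pv p \<bullet> y)) = 0"
    \<comment> \<open>The zero vector is not in \<open>W\<close>, so \<open>z = 0\<close> is treated
      apart.\<close>
    proof (cases "z = 0")
      case True
      then show ?thesis by (simp add: lin_0)
    next
      case False
      then have "expand_row (z \<cdot>\<^sub>v pv p) \<in> W" using p by (auto simp: W_def)
      from ker[OF this] z show ?thesis
        unfolding expand_row_orthogonal_iff[OF x(1)] expand_row_orthogonal_iff[OF y(1)] by simp
    qed
  qed
  then have "\<exists>a. y = \<iota> a \<cdot>\<^sub>v x"
    by (intro pair_vec_proportional[OF \<alpha> ratio x(1) y(1)])
  then obtain a where "y = \<iota> a \<cdot>\<^sub>v x" by blast
  then have "c' = a \<cdot>\<^sub>v c"
    using ux by (simp add: x(2) y(2) expand_col_scale mult_mat_vec[of _ "dim_col G" "dim_row G"])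
  then show "\<exists>a. c' = a \<cdot>\<^sub>v c" ..
qed

end

text \<open>The size of the matrices comes from the image \<open>mat_algebra M\<close>, whose
  elements are as large as \<open>M\<close>.\<close>

lemma algebra_iso_quadratic_matrix_rep:
  fixes \<iota> :: "'a::{field,finite} \<Rightarrow> 'b::{field,finite}"
  assumes "field_hom \<iota>" "CARD('b) = CARD('a)\<^sup>2" "algebra_iso \<iota> \<phi> M" "dim_row M = 2"
  shows "quadratic_matrix_rep \<iota> \<phi>"
proof -
  have iso: "bij_betw \<phi> UNIV (mat_algebra M)" "\<phi> 1 = 1\<^sub>m 2" "\<forall>x y. \<phi> (x + y) = \<phi> x + \<phi> y"
    "\<forall>x y. \<phi> (x * y) = \<phi> x * \<phi> y" "\<forall>a x. \<phi> (\<iota> a * x) = a \<cdot>\<^sub>m \<phi> x"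
    using assms(3) unfolding algebra_iso_def assms(4) by - (elim conjE, assumption)+
  have "\<phi> x \<in> carrier_mat 2 2" for x
  proof -
    have "\<phi> x \<in> mat_algebra M" using iso(1) by (rule bij_betw_apply) (rule UNIV_I)
    then show ?thesis using assms(4) by (auto simp: mat_algebra_def poly_of_mat_def)
  qed
  then show ?thesis
    by (intro quadratic_matrix_rep.intro quadratic_matrix_rep_axioms.intro assms(1,2)
        iso(2) iso(3-)[rule_format])
qed

theorem proposition4p12:
  fixes \<iota> :: "'a::{field,finite} \<Rightarrow> 'b::{field,finite}"
    and \<gamma> :: 'b and M :: "'a mat" and \<phi> :: "'b \<Rightarrow> 'a mat"
    and q t k :: nat and i j :: "nat \<Rightarrow> nat \<Rightarrow> nat" and G :: "'a mat"
  assumes "card (UNIV :: 'a set) = q" and "card (UNIV :: 'b set) = q\<^sup>2" and "field_hom \<iota>"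
    and "t \<ge> 1" and "k = 2 * t"
    and "primitive_element \<gamma>"
    and "M = companion_mat (min_poly \<iota> \<gamma>)"
    and "algebra_iso \<iota> \<phi> M" and "\<phi> \<gamma> = M"
    and "\<And>l m. l < m \<Longrightarrow> m < t \<Longrightarrow>
           i l m \<in> {1..q\<^sup>2 - 1} \<and> j l m \<in> {1..q\<^sup>2 - 1} \<and>
           \<not> int (q + 1) dvd int (j l m) - int (i l m)"
    and "dim_row G = k"
    and "columns_represent G (\<Union>L\<in>code_lines \<phi> \<gamma> t i j. points_of L)"
  shows "linear_code ((q + 1) * k\<^sup>2 div 4) k (q * (k - 1)) (generated_code G) \<and>
         minimal_code (generated_code G)"
proof -
  have q2: "CARD('b) = CARD('a)\<^sup>2" using assms(1,2) by simp
  have "dim_row M = 2"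
    using degree_min_poly_primitive[OF assms(3) q2 assms(6)] assms(7)
    by (simp add: companion_mat_def Let_def)
  then interpret quadratic_matrix_rep \<iota> \<phi>
    using algebra_iso_quadratic_matrix_rep[OF assms(3) q2 assms(8)] by simp
  interpret projective_system_code \<iota> \<phi> t "\<lambda>l m. \<gamma> ^ i l m" "\<lambda>l m. \<gamma> ^ j l m" G
  proof
    show "\<gamma> ^ i l m \<noteq> 0" for l m
      using primitive_element_nonzero[OF assms(6)] by simp
    show "\<gamma> ^ j l m \<noteq> \<iota> c * \<gamma> ^ i l m" if "l < m" "m < t" for l m c
      using primitive_element_power_ratio[OF assms(3) q2 assms(6)] assms(1) assms(10)[OF that] by blast
    show "columns_represent G (\<Union>p\<in>{..<t} \<times> {..<t}. points_of (field_reduction \<phi>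
        (proj_point (pair_vec t (\<lambda>l m. \<gamma> ^ i l m) (\<lambda>l m. \<gamma> ^ j l m) p))))"
      using assms(12) by (simp only: code_lines_eq UN_simps)
  qed (use assms in auto)
  \<comment> \<open>Since \<open>k = 2 * t\<close>, the division by 4 is exact.\<close>
  have "(q + 1) * k\<^sup>2 div 4 = dim_col G"
    using assms(1,5) by (simp add: length_code power2_eq_square)
  then show ?thesis
    using linear_code_generated minimal_code_generated assms(1,5) by simp
qed

end
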